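(* For all $\theta\in\mathbb R\setminus\mathbb Q$ and all $\nu\in\mathbb P_\varepsilon^{\rm bg}(\theta)$, ${}^*\mathbb Z^{\rm sym}_\nu(\theta)\ne0$ (that is, it contains a nonzero element). In particular, if $\theta$ is badly approximable, then ${}^*\mathbb Z^{\rm sym}_\nu(\theta)\neq0$ for all $\nu\in\mathbb P_\varepsilon$.
   Context: Fix a nonprincipal ultrafilter $\mathfrak u$ on $\mathbb N$, and let ${}^*\mathbb Z\subset{}^*\mathbb R$ be the ultrapowers of $\mathbb Z\subset\mathbb R$. Let ${}^*\mathbb R_{\rm fin}$ be the ring of bounded elements, ${}^*\mathbb R_\varepsilon$ its ideal of infinitesimals, and $({}^*\mathbb R_{\rm fin})^\times_+$ the multiplicative group of positive elements that are neither infinite nor infinitesimal. Let $\mathbb P:=({}^*\mathbb R_{>0}\cup\{0\})/({}^*\mathbb R_{\rm fin})^\times_+$; write $\langle x\rangle\in\mathbb P$ for the class of $|x|$. $\mathbb P_\varepsilon\subset\mathbb P$ is the set of classes of positive infinitesimals. For $0\ne n\in{}^*\mathbb Z$ put $\mu(n):=\langle n\rangle^{-1}$. For $\theta\in\mathbb R$, ${}^*\mathbb Z(\theta)$ is the group of $n\in{}^*\mathbb Z$ for which there is a (unique) $n^\perp\in{}^*\mathbb Z$ with $\varepsilon(n):=n\theta-n^\perp\in{}^*\mathbb R_\varepsilon$; put $\nu(n):=\langle\varepsilon(n)\rangle$. The set of symmetric diophantine approximations is ${}^*\mathbb Z^{\rm sym}(\theta):=\{0\ne n\in{}^*\mathbb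 Z(\theta): |n|\cdot|\varepsilon(n)|\text{ is neither infinite nor infinitesimal}\}\cup\{0\}$; equivalently, its nonzero elements are those $n\ne0$ in ${}^*\mathbb Z(\theta)$ with $\mu(n)=\nu(n)$. For $\nu\in\mathbb P_\varepsilon$, ${}^*\mathbb Z^{\rm sym}_\nu(\theta):=\{n\in{}^*\mathbb Z^{\rm sym}(\theta):\nu(n)=\nu\}$. Let $\theta\in\mathbb R\setminus\mathbb Q$ have continued fraction expansion $[a_0a_1a_2\dots]$ with convergent denominators $q_0=1$, $q_1=a_1$, $q_{i+1}=a_{i+1}q_i+q_{i-1}$. A best denominator class is the class $\widehat q\in{}^*\mathbb Z(\theta)$ of a sequence $\{q_{n_i}\}_i$ with $n_i\le n_{i+1}$ for all $i$ and $n_i\to\infty$. $\mathbb P_\varepsilon^{\rm bg}(\theta)\subset\mathbb P_\varepsilon$ is the set of growths $\mu(\widehat q)$ of best denominator classes $\widehat q$. $\theta$ irrational is badly approximable if $\liminf_{n\to\infty}n\|n\theta\|>0$, where $\|\cdot\|$ is the distance to the nearest integer. *)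

theory Defs
  imports Complex_Main "HOL-Library.Extended_Real"
begin

section \<open>Ultrapowers\<close>

definition ultrafilter :: "'a filter \<Rightarrow> bool" where
  "ultrafilter F \<longleftrightarrow> F \<noteq> bot \<and> (\<forall>P. eventually P F \<or> eventually (\<lambda>x. \<not> P x) F)"

definition nonprincipal :: "'a filter \<Rightarrow> bool" where
  "nonprincipal F \<longleftrightarrow> (\<forall>a. F \<noteq> principal {a})"

definition ultra_rel :: "nat filter \<Rightarrow> ((nat \<Rightarrow> 'a) \<times> (nat \<Rightarrow> 'a)) set" where
  "ultra_rel U = {(x, y). eventually (\<lambda>i. x i = y i) U}"

definition ultra_class :: "nat filter \<Rightarrow> (nat \<Rightarrow> 'a) \<Rightarrow> (nat \<Rightarrow> 'a) set" where
  "ultra_class U x = ultra_rel U `` {x}"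

text \<open>
  The operations below act on elements of the ultrapower, i.e. on classes of sequences. They are
  defined through representatives; independence of the representatives is shown at the end of
  this section.
\<close>

definition star_map :: "nat filter \<Rightarrow> ('a \<Rightarrow> 'b) \<Rightarrow> (nat \<Rightarrow> 'a) set \<Rightarrow> (nat \<Rightarrow> 'b) set" where
  "star_map U f X = (\<Union>x\<in>X. ultra_class U (\<lambda>i. f (x i)))"

definition star_map2 ::
  "nat filter \<Rightarrow> ('a \<Rightarrow> 'b \<Rightarrow> 'c) \<Rightarrow> (nat \<Rightarrow> 'a) set \<Rightarrow> (nat \<Rightarrow> 'b) set \<Rightarrow> (nat \<Rightarrow> 'c) set" where
  "star_map2 U f X Y = (\<Union>x\<in>X. \<Union>y\<in>Y. ultra_class U (\<lambda>i. f (x i) (y i)))"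

definition star_rel ::
  "nat filter \<Rightarrow> ('a \<Rightarrow> 'b \<Rightarrow> bool) \<Rightarrow> (nat \<Rightarrow> 'a) set \<Rightarrow> (nat \<Rightarrow> 'b) set \<Rightarrow> bool" where
  "star_rel U R X Y \<longleftrightarrow> (\<exists>x\<in>X. \<exists>y\<in>Y. eventually (\<lambda>i. R (x i) (y i)) U)"

definition star_of :: "nat filter \<Rightarrow> 'a \<Rightarrow> (nat \<Rightarrow> 'a) set" where
  "star_of U a = ultra_class U (\<lambda>_. a)"

lemma equiv_ultra_rel: "equiv UNIV (ultra_rel U)"
  by (rule equivI) (auto simp: ultra_rel_def refl_on_def sym_def trans_def eq_commute
        elim: eventually_elim2)

lemma ultra_class_eq_iff:
  "ultra_class U x = ultra_class U y \<longleftrightarrow> eventually (\<lambda>i. x i = y i) U"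
  unfolding ultra_class_def using eq_equiv_class_iff[OF equiv_ultra_rel, of x y U]
  by (simp add: ultra_rel_def)

lemma star_map_ultra_class:
  "star_map U f (ultra_class U x) = ultra_class U (\<lambda>i. f (x i))"
proof -
  have "ultra_class U (\<lambda>i. f (y i)) = ultra_class U (\<lambda>i. f (x i))" if "y \<in> ultra_class U x" for y
    using that unfolding ultra_class_eq_iff
    by (auto simp: ultra_class_def ultra_rel_def elim: eventually_mono)
  moreover have "x \<in> ultra_class U x" by (simp add: ultra_class_def ultra_rel_def)
  ultimately show ?thesis unfolding star_map_def by blast
qed

lemma star_map2_ultra_class:
  "star_map2 U f (ultra_class U x) (ultra_class U y) = ultra_class U (\<lambda>i. f (x i) (y i))"
proof -
  have "ultra_class U (\<lambda>i. f (x' i) (y' i)) = ultra_class U (\<lambda>i. f (x i) (y i))"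
    if "x' \<in> ultra_class U x" "y' \<in> ultra_class U y" for x' y'
    using that unfolding ultra_class_eq_iff
    by (auto simp: ultra_class_def ultra_rel_def elim: eventually_elim2)
  moreover have "x \<in> ultra_class U x" "y \<in> ultra_class U y"
    by (simp_all add: ultra_class_def ultra_rel_def)
  ultimately show ?thesis unfolding star_map2_def by blast
qed

lemma star_rel_ultra_class:
  "star_rel U R (ultra_class U x) (ultra_class U y) \<longleftrightarrow> eventually (\<lambda>i. R (x i) (y i)) U"
proof
  assume "star_rel U R (ultra_class U x) (ultra_class U y)"
  then obtain x' y' where "eventually (\<lambda>i. x i = x' i) U" "eventually (\<lambda>i. y i = y' i) U"
    "eventually (\<lambda>i. R (x' i) (y' i)) U"
    by (auto simp: star_rel_def ultra_class_def ultra_rel_def)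
  then show "eventually (\<lambda>i. R (x i) (y i)) U"
    by eventually_elim simp
next
  assume "eventually (\<lambda>i. R (x i) (y i)) U"
  moreover have "x \<in> ultra_class U x" "y \<in> ultra_class U y"
    by (simp_all add: ultra_class_def ultra_rel_def)
  ultimately show "star_rel U R (ultra_class U x) (ultra_class U y)"
    unfolding star_rel_def by blast
qed


section \<open>Hyperreals and growth classes\<close>

type_synonym hyperreal = "(nat \<Rightarrow> real) set"

definition star_Reals :: "nat filter \<Rightarrow> hyperreal set" where
  "star_Reals U = UNIV // ultra_rel U"

text \<open>The ultrapower of the integers, as a subset of that of the reals.\<close>

definition star_Ints :: "nat filter \<Rightarrow> hyperreal set" where
  "star_Ints U = {ultra_class U x | x. \<forall>i. x i \<in> \<int>}"

abbreviation star_abs :: "nat filter \<Rightarrow> hyperreal \<Rightarrow> hyperreal" where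
  "star_abs U \<equiv> star_map U abs"

abbreviation star_times :: "nat filter \<Rightarrow> hyperreal \<Rightarrow> hyperreal \<Rightarrow> hyperreal" where
  "star_times U \<equiv> star_map2 U (*)"

abbreviation star_minus :: "nat filter \<Rightarrow> hyperreal \<Rightarrow> hyperreal \<Rightarrow> hyperreal" where
  "star_minus U \<equiv> star_map2 U (-)"

abbreviation star_less :: "nat filter \<Rightarrow> hyperreal \<Rightarrow> hyperreal \<Rightarrow> bool" where
  "star_less U \<equiv> star_rel U (<)"

abbreviation star_le :: "nat filter \<Rightarrow> hyperreal \<Rightarrow> hyperreal \<Rightarrow> bool" where
  "star_le U \<equiv> star_rel U (\<le>)"

definition star_Fin :: "nat filter \<Rightarrow> hyperreal set" where
  "star_Fin U = {x \<in> star_Reals U. \<exists>r::real. star_le U (star_abs U x) (star_of U r)}"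

definition star_Eps :: "nat filter \<Rightarrow> hyperreal set" where
  "star_Eps U = {x \<in> star_Reals U. \<forall>r::real. r > 0 \<longrightarrow> star_less U (star_abs U x) (star_of U r)}"

definition star_Fin_units_pos :: "nat filter \<Rightarrow> hyperreal set" where
  "star_Fin_units_pos U = {x \<in> star_Fin U - star_Eps U. star_less U (star_of U 0) x}"

definition star_nonneg :: "nat filter \<Rightarrow> hyperreal set" where
  "star_nonneg U = {x \<in> star_Reals U. star_less U (star_of U 0) x} \<union> {star_of U 0}"

type_synonym growth = "hyperreal set"

definition growth_rel :: "nat filter \<Rightarrow> (hyperreal \<times> hyperreal) set" where
  "growth_rel U = {(x, y). x \<in> star_nonneg U \<and> y \<in> star_nonneg U \<and>
     (\<exists>c \<in> star_Fin_units_pos U. y = star_times U c x)}"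

definition Growths :: "nat filter \<Rightarrow> growth set" where
  "Growths U = star_nonneg U // growth_rel U"

definition growth_of :: "nat filter \<Rightarrow> hyperreal \<Rightarrow> growth" where
  "growth_of U x = growth_rel U `` {star_abs U x}"

definition Growths_eps :: "nat filter \<Rightarrow> growth set" where
  "Growths_eps U = {growth_of U x | x. x \<in> star_Eps U \<and> star_less U (star_of U 0) x}"

definition growth_inverse :: "nat filter \<Rightarrow> growth \<Rightarrow> growth" where
  "growth_inverse U g = (\<Union>x\<in>g. growth_of U (star_map U inverse x))"


section \<open>Diophantine approximation groups\<close>

definition mu_growth :: "nat filter \<Rightarrow> hyperreal \<Rightarrow> growth" where
  "mu_growth U n = growth_inverse U (growth_of U n)"

definition star_Ints_approx :: "nat filter \<Rightarrow> real \<Rightarrow> hyperreal set" where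
  "star_Ints_approx U \<theta> = {n \<in> star_Ints U. \<exists>m \<in> star_Ints U.
     star_minus U (star_times U n (star_of U \<theta>)) m \<in> star_Eps U}"

definition perp :: "nat filter \<Rightarrow> real \<Rightarrow> hyperreal \<Rightarrow> hyperreal" where
  "perp U \<theta> n = (THE m. m \<in> star_Ints U \<and>
     star_minus U (star_times U n (star_of U \<theta>)) m \<in> star_Eps U)"

definition approx_error :: "nat filter \<Rightarrow> real \<Rightarrow> hyperreal \<Rightarrow> hyperreal" where
  "approx_error U \<theta> n = star_minus U (star_times U n (star_of U \<theta>)) (perp U \<theta> n)"

definition nu_growth :: "nat filter \<Rightarrow> real \<Rightarrow> hyperreal \<Rightarrow> growth" where
  "nu_growth U \<theta> n = growth_of U (approx_error U \<theta> n)"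

definition star_Ints_sym :: "nat filter \<Rightarrow> real \<Rightarrow> hyperreal set" where
  "star_Ints_sym U \<theta> = {n \<in> star_Ints_approx U \<theta>. n \<noteq> star_of U 0 \<and>
      star_times U (star_abs U n) (star_abs U (approx_error U \<theta> n)) \<in> star_Fin U - star_Eps U}
    \<union> {star_of U 0}"

definition star_Ints_sym_nu :: "nat filter \<Rightarrow> real \<Rightarrow> growth \<Rightarrow> hyperreal set" where
  "star_Ints_sym_nu U \<theta> \<nu> = {n \<in> star_Ints_sym U \<theta>. nu_growth U \<theta> n = \<nu>}"


section \<open>Continued fractions and best denominator classes\<close>

fun complete_quotient :: "real \<Rightarrow> nat \<Rightarrow> real" where
  "complete_quotient \<theta> 0 = \<theta>"
| "complete_quotient \<theta> (Suc i) = 1 / frac (complete_quotient \<theta> i)"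

definition partial_quotient :: "real \<Rightarrow> nat \<Rightarrow> int" where
  "partial_quotient \<theta> i = \<lfloor>complete_quotient \<theta> i\<rfloor>"

fun cf_denom :: "real \<Rightarrow> nat \<Rightarrow> int" where
  "cf_denom \<theta> 0 = 1"
| "cf_denom \<theta> (Suc 0) = partial_quotient \<theta> 1"
| "cf_denom \<theta> (Suc (Suc i)) =
     partial_quotient \<theta> (Suc (Suc i)) * cf_denom \<theta> (Suc i) + cf_denom \<theta> i"

definition best_denom_classes :: "nat filter \<Rightarrow> real \<Rightarrow> hyperreal set" where
  "best_denom_classes U \<theta> = {ultra_class U (\<lambda>i. real_of_int (cf_denom \<theta> (k i))) | k.
     (\<forall>i. k i \<le> k (Suc i)) \<and> filterlim k at_top sequentially}"

definition Growths_bg :: "nat filter \<Rightarrow> real \<Rightarrow> growth set" where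
  "Growths_bg U \<theta> = {mu_growth U q | q. q \<in> best_denom_classes U \<theta>}"

definition dist_nearest_int :: "real \<Rightarrow> real" where
  "dist_nearest_int x = \<bar>x - real_of_int (round x)\<bar>"

definition badly_approximable :: "real \<Rightarrow> bool" where
  "badly_approximable \<theta> \<longleftrightarrow> \<theta> \<notin> \<rat> \<and>
     liminf (\<lambda>n. ereal (real n * dist_nearest_int (real n * \<theta>))) > 0"

end

theory Submission imports Defs begin

text \<open>
  Let $D_k = |q_k\theta - p_k|$. Then $q_{k+1} D_k + q_k D_{k+1} = 1$, so $D_k$ is of the exact order
  of $1/q_{k+1}$. Since the errors of consecutive convergents have opposite signs, the integer
  $2 q_{k+1} - q_k$ lies between $q_{k+1}$ and $2 q_{k+1}$ and has error
  $2 D_{k+1} + D_k$, of the exact order of $1/q_{k+1}$; this gives a symmetric approximation whose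
  growth is the one of $q_{k+1}$.
  If $\theta$ is badly approximable and $Q \ge 1$ is arbitrary, the $q_k$ with
  $q_k \le Q < q_{k+1}$ has error at most $1/Q$, and bad approximability forces
  $q_k$ and its error to be of the exact orders of $Q$ and $1/Q$.
\<close>

section \<open>Continued fractions\<close>

text \<open>For irrational \<theta> this product is the distance D_k = |q_k \<theta> - p_k|, as
  \<open>cf_error_eq_denom_times_minus_int\<close> confirms. The product form gives positivity and
  monotonicity at once, since every factor lies strictly between 0 and 1.\<close>

definition cf_error :: "real \<Rightarrow> nat \<Rightarrow> real" where
  "cf_error \<theta> k = (\<Prod>j\<le>k. frac (complete_quotient \<theta> j))"

lemma complete_quotient_irrational:
  assumes "\<theta> \<notin> \<rat>"
  shows "complete_quotient \<theta> k \<notin> \<rat>"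
proof (induction k)
  case (Suc k)
  \<comment> \<open>This also holds when the fractional part vanishes: division by zero gives 0, so
    both sides are then the floor.\<close>
  have "complete_quotient \<theta> k = 1 / complete_quotient \<theta> (Suc k) + of_int \<lfloor>complete_quotient \<theta> k\<rfloor>"
    by (simp add: frac_def)
  then show ?case
    using Suc by (metis Rats_1 Rats_add Rats_divide Rats_of_int)
qed (simp add: assms)

lemma frac_complete_quotient_pos:
  assumes "\<theta> \<notin> \<rat>"
  shows "frac (complete_quotient \<theta> k) > 0"
proof -
  have "complete_quotient \<theta> k \<notin> \<int>"
    using complete_quotient_irrational[OF assms] Ints_subset_Rats by blast
  then show ?thesis by simp
qed

lemma inverse_frac_complete_quotient:
  "1 / frac (complete_quotient \<theta> k) =
     of_int (partial_quotient \<theta> (Suc k)) + frac (complete_quotient \<theta> (Suc k))"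
  by (simp add: partial_quotient_def frac_def)

lemma partial_quotient_Suc_ge_1:
  assumes "\<theta> \<notin> \<rat>"
  shows "partial_quotient \<theta> (Suc k) \<ge> 1"
  using frac_complete_quotient_pos[OF assms, of k] frac_lt_1[of "complete_quotient \<theta> k"]
  by (simp add: partial_quotient_def)

lemma cf_error_pos: "\<theta> \<notin> \<rat> \<Longrightarrow> cf_error \<theta> k > 0"
  unfolding cf_error_def by (intro prod_pos ballI frac_complete_quotient_pos)

lemma cf_error_Suc: "cf_error \<theta> (Suc k) = cf_error \<theta> k * frac (complete_quotient \<theta> (Suc k))"
  by (simp add: cf_error_def)

lemma cf_error_Suc_le:
  assumes "\<theta> \<notin> \<rat>"
  shows "cf_error \<theta> (Suc k) \<le> cf_error \<theta> k"
  unfolding cf_error_Suc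
  using cf_error_pos[OF assms, of k] frac_lt_1[of "complete_quotient \<theta> (Suc k)"]
  by (intro mult_right_le_one_le) (simp_all add: less_imp_le)

text \<open>The fractional part at \<open>Suc (Suc k)\<close> is 1/t minus the partial quotient,
  where t is the one at \<open>Suc k\<close>. Multiplying by D_(k+1) = D_k t gives the recurrence,
  which is the one for the denominators with the sign of the partial quotient reversed.\<close>

lemma cf_error_Suc_Suc:
  assumes "\<theta> \<notin> \<rat>"
  shows "cf_error \<theta> (Suc (Suc k)) =
    cf_error \<theta> k - of_int (partial_quotient \<theta> (Suc (Suc k))) * cf_error \<theta> (Suc k)"
proof -
  let ?t = "frac (complete_quotient \<theta> (Suc k))"
  have t: "frac (complete_quotient \<theta> (Suc (Suc k))) = 1 / ?t - of_int (partial_quotient \<theta> (Suc (Suc k)))"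
    using inverse_frac_complete_quotient[of \<theta> "Suc k"] by linarith
  have "?t > 0" by (rule frac_complete_quotient_pos[OF assms])
  then show ?thesis
    unfolding cf_error_Suc[of \<theta> "Suc k"] t by (simp add: cf_error_Suc field_simps del: complete_quotient.simps)
qed

section \<open>Growth of the convergent denominators\<close>

lemma cf_denom_ge_1:
  assumes "\<theta> \<notin> \<rat>"
  shows "cf_denom \<theta> k \<ge> 1"
\<comment> \<open>The predicate ignores its real argument, which turns the recursion rule into a
  two-step induction on the index alone.\<close>
proof (induction k rule: cf_denom.induct[where P = "\<lambda>_ k. cf_denom \<theta> k \<ge> 1", case_names zero one step])
  case (step \<theta>' k)
  have "1 * 1 \<le> partial_quotient \<theta> (Suc (Suc k)) * cf_denom \<theta> (Suc k)"
    using step partial_quotient_Suc_ge_1[OF assms, of "Suc k"] by (intro mult_mono) auto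
  then show ?case using step by simp
qed (use partial_quotient_Suc_ge_1[OF assms, of 0] in auto)

lemma cf_denom_Suc_Suc_ge:
  assumes "\<theta> \<notin> \<rat>"
  shows "cf_denom \<theta> (Suc k) + cf_denom \<theta> k \<le> cf_denom \<theta> (Suc (Suc k))"
proof -
  have "1 * cf_denom \<theta> (Suc k) \<le> partial_quotient \<theta> (Suc (Suc k)) * cf_denom \<theta> (Suc k)"
    using cf_denom_ge_1[OF assms, of "Suc k"] partial_quotient_Suc_ge_1[OF assms, of "Suc k"]
    by (intro mult_right_mono) auto
  then show ?thesis by simp
qed

lemma cf_denom_le_Suc:
  assumes "\<theta> \<notin> \<rat>"
  shows "cf_denom \<theta> k \<le> cf_denom \<theta> (Suc k)"
proof (cases k)
  case 0
  then show ?thesis using cf_denom_ge_1[OF assms, of 1] by simp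
next
  case (Suc j)
  then show ?thesis
    using cf_denom_Suc_Suc_ge[OF assms, of j] cf_denom_ge_1[OF assms, of j] by simp
qed

text \<open>A crude linear bound, enough to make the denominators unbounded. The step from 0 to 1 is
  separate because q_1 = q_0 = 1 is possible; afterwards each step gains at least q_j, hence at
  least 1.\<close>

lemma cf_denom_ge_index:
  assumes "\<theta> \<notin> \<rat>"
  shows "int k \<le> cf_denom \<theta> k"
proof (induction k)
  case (Suc k)
  show ?case
  proof (cases k)
    case 0
    then show ?thesis using cf_denom_ge_1[OF assms, of 1] by simp
  next
    case (Suc j)
    then show ?thesis
      using \<open>int k \<le> cf_denom \<theta> k\<close> cf_denom_Suc_Suc_ge[OF assms, of j] cf_denom_ge_1[OF assms, of j]
      by (simp del: cf_denom.simps)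
  qed
qed simp

text \<open>An absolute-value form of the determinant identity for consecutive convergents. In the
  induction step the partial quotient enters the two recurrences with opposite signs and
  cancels.\<close>

lemma cf_denom_cf_error:
  assumes "\<theta> \<notin> \<rat>"
  shows "of_int (cf_denom \<theta> (Suc k)) * cf_error \<theta> k + of_int (cf_denom \<theta> k) * cf_error \<theta> (Suc k) = 1"
proof (induction k)
  case 0
  have "frac \<theta> > 0" using frac_complete_quotient_pos[OF assms, of 0] by simp
  then have "frac \<theta> * (of_int (partial_quotient \<theta> (Suc 0)) + frac (1 / frac \<theta>)) = 1"
    using inverse_frac_complete_quotient[of \<theta> 0] by (simp add: field_simps)
  then show ?case by (simp add: cf_error_def algebra_simps)
next
  case (Suc k)
  then show ?case
    by (simp add: cf_error_Suc_Suc[OF assms] algebra_simps del: complete_quotient.simps)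
qed

lemma cf_error_le:
  assumes "\<theta> \<notin> \<rat>"
  shows "cf_error \<theta> k \<le> 1 / of_int (cf_denom \<theta> (Suc k))"
proof -
  have "0 \<le> of_int (cf_denom \<theta> k) * cf_error \<theta> (Suc k)"
    using cf_denom_ge_1[OF assms, of k] cf_error_pos[OF assms, of "Suc k"] by simp
  then show ?thesis
    using cf_denom_cf_error[OF assms, of k] cf_denom_ge_1[OF assms, of "Suc k"]
    by (simp add: field_simps)
qed

text \<open>Denominators increase and errors decrease, so the first of the two summands in
  \<open>cf_denom_cf_error\<close> is the larger one and is at least 1/2.\<close>

lemma cf_error_ge:
  assumes "\<theta> \<notin> \<rat>"
  shows "1 / (2 * of_int (cf_denom \<theta> (Suc k))) \<le> cf_error \<theta> k"
proof -
  have "of_int (cf_denom \<theta> k) * cf_error \<theta> (Suc k) \<le> of_int (cf_denom \<theta> (Suc k)) * cf_error \<theta> k"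
    using cf_denom_ge_1[OF assms, of "Suc k"] cf_error_pos[OF assms, of "Suc k"]
      cf_denom_le_Suc[OF assms] cf_error_Suc_le[OF assms] by (intro mult_mono) auto
  then show ?thesis
    using cf_denom_cf_error[OF assms, of k] cf_denom_ge_1[OF assms, of "Suc k"]
    by (simp add: field_simps)
qed

text \<open>The numerators are kept existential, since only their integrality matters. The
  alternating sign is what later lets the errors of two consecutive convergents add up without
  cancellation.\<close>

lemma cf_error_eq_denom_times_minus_int:
  assumes "\<theta> \<notin> \<rat>"
  shows "\<exists>p::int. of_int (cf_denom \<theta> k) * \<theta> - of_int p = (-1) ^ k * cf_error \<theta> k"
proof (induction k rule: cf_denom.induct[where
      P = "\<lambda>_ k. \<exists>p::int. of_int (cf_denom \<theta> k) * \<theta> - of_int p = (-1) ^ k * cf_error \<theta> k",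
      case_names zero one step])
  case zero
  show ?case by (rule exI[of _ "\<lfloor>\<theta>\<rfloor>"]) (simp add: cf_error_def frac_def)
next
  case one
  have "frac \<theta> > 0" using frac_complete_quotient_pos[OF assms, of 0] by simp
  then have "cf_error \<theta> 1 = 1 - of_int (partial_quotient \<theta> 1) * frac \<theta>"
    using inverse_frac_complete_quotient[of \<theta> 0]
    by (simp add: cf_error_def field_simps)
  then show ?case
    by (intro exI[of _ "partial_quotient \<theta> 1 * \<lfloor>\<theta>\<rfloor> + 1"]) (simp add: frac_def algebra_simps)
next
  case (step \<theta>' k)
  then obtain p p' :: int where
    p: "of_int (cf_denom \<theta> k) * \<theta> - of_int p = (-1) ^ k * cf_error \<theta> k" and
    p': "of_int (cf_denom \<theta> (Suc k)) * \<theta> - of_int p' = (-1) ^ Suc k * cf_error \<theta> (Suc k)"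
    by blast
  let ?a = "partial_quotient \<theta> (Suc (Suc k))"
  have "of_int (cf_denom \<theta> (Suc (Suc k))) * \<theta> - of_int (?a * p' + p) =
      of_int ?a * (of_int (cf_denom \<theta> (Suc k)) * \<theta> - of_int p') + (of_int (cf_denom \<theta> k) * \<theta> - of_int p)"
    by (simp add: algebra_simps)
  also have "\<dots> = (-1) ^ Suc (Suc k) * cf_error \<theta> (Suc (Suc k))"
    unfolding p p' cf_error_Suc_Suc[OF assms] by (simp add: algebra_simps)
  finally show ?case by blast
qed

section \<open>Integers of prescribed size with error of the inverse size\<close>

lemma symmetric_approximation_cf_denom:
  assumes "\<theta> \<notin> \<rat>" and "k > 0"
  defines "q \<equiv> real_of_int (cf_denom \<theta> k)"
  shows "\<exists>n m::int. q \<le> \<bar>of_int n\<bar> \<and> \<bar>of_int n\<bar> \<le> 3 * q \<and>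
    1/2 * (1 / q) \<le> \<bar>of_int n * \<theta> - of_int m\<bar> \<and> \<bar>of_int n * \<theta> - of_int m\<bar> \<le> 3 * (1 / q)"
proof -
  obtain j where k: "k = Suc j" using \<open>k > 0\<close> gr0_implies_Suc by blast
  obtain p p' :: int where
    p: "of_int (cf_denom \<theta> j) * \<theta> - of_int p = (-1) ^ j * cf_error \<theta> j" and
    p': "of_int (cf_denom \<theta> k) * \<theta> - of_int p' = (-1) ^ k * cf_error \<theta> k"
    using cf_error_eq_denom_times_minus_int[OF assms(1)] by meson
  \<comment> \<open>The error of q_k itself may be far smaller than 1/q_k, so its predecessor is
    brought in to supply an error of that order. It is subtracted because the signs are opposite,
    and the factor 2 keeps \<open>n\<close> at least q_k.\<close>
  define n where "n = 2 * cf_denom \<theta> k - cf_denom \<theta> j"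
  define m where "m = 2 * p' - p"
  have "of_int n * \<theta> - of_int m =
      2 * (of_int (cf_denom \<theta> k) * \<theta> - of_int p') - (of_int (cf_denom \<theta> j) * \<theta> - of_int p)"
    by (simp add: n_def m_def algebra_simps)
  also have "\<dots> = (-1) ^ k * (2 * cf_error \<theta> k + cf_error \<theta> j)"
    unfolding p p' by (simp add: k algebra_simps)
  finally have err: "\<bar>of_int n * \<theta> - of_int m\<bar> = 2 * cf_error \<theta> k + cf_error \<theta> j"
    using cf_error_pos[OF assms(1), of k] cf_error_pos[OF assms(1), of j]
    by (simp add: abs_mult power_abs)
  \<comment> \<open>These bound the error 2 D_k + D_j by 3 D_j, hence by 3/q. The size bound 2 q is
    relaxed to 3 q below so that one constant serves both estimates.\<close>
  have "cf_error \<theta> k \<le> cf_error \<theta> j" "cf_error \<theta> j \<le> 1 / q" "1/2 * (1 / q) \<le> cf_error \<theta> j"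
    using cf_error_Suc_le[OF assms(1), of j] cf_error_le[OF assms(1), of j]
      cf_error_ge[OF assms(1), of j] by (simp_all add: q_def k)
  moreover have "cf_denom \<theta> k \<le> n" "n \<le> 2 * cf_denom \<theta> k" "1 \<le> cf_denom \<theta> k"
    using cf_denom_le_Suc[OF assms(1), of j] cf_denom_ge_1[OF assms(1), of j]
      cf_denom_ge_1[OF assms(1), of k] by (simp_all add: n_def k)
  then have "q \<le> \<bar>of_int n\<bar>" "\<bar>of_int n\<bar> \<le> 3 * q" by (simp_all add: q_def)
  ultimately show ?thesis
    using err cf_error_pos[OF assms(1), of k] by (intro exI[of _ n] exI[of _ m]) auto
qed

text \<open>The liminf controls only large n; the finitely many remaining values are positive
  because \<theta> is irrational, so a minimum gives a uniform constant.\<close>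

lemma badly_approximable_lower_bound:
  assumes "badly_approximable \<theta>"
  obtains c where "c > 0" and "\<And>n::nat. n > 0 \<Longrightarrow> c \<le> real n * dist_nearest_int (real n * \<theta>)"
proof -
  define f where "f n = real n * dist_nearest_int (real n * \<theta>)" for n
  have "liminf (\<lambda>n. ereal (f n)) > 0" and irr: "\<theta> \<notin> \<rat>"
    using assms by (simp_all add: badly_approximable_def f_def)
  then obtain c0 where c0: "0 < c0" "ereal c0 < liminf (\<lambda>n. ereal (f n))"
    using ereal_dense2[of 0] by auto
  from less_LiminfD[OF c0(2)] obtain N where N: "\<And>n. n \<ge> N \<Longrightarrow> c0 < f n"
    by (auto simp: eventually_sequentially)
  have pos: "f n > 0" if "n > 0" for n
  proof -
    have "real n * \<theta> \<noteq> of_int (round (real n * \<theta>))"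
    proof
      assume "real n * \<theta> = of_int (round (real n * \<theta>))"
      then have "\<theta> = of_int (round (real n * \<theta>)) / of_nat n" using that by (simp add: field_simps)
      then show False using irr by (metis Rats_divide Rats_of_int Rats_of_nat)
    qed
    then show ?thesis using that by (simp add: f_def dist_nearest_int_def)
  qed
  \<comment> \<open>Inserting \<open>c0\<close> covers the indices from \<open>N\<close> on and
    keeps the set nonempty.\<close>
  define c where "c = Min (insert c0 (f ` {0<..<N}))"
  have "c > 0" unfolding c_def using c0 pos by auto
  moreover have "c \<le> f n" if "n > 0" for n
  proof (cases "n < N")
    case True
    then show ?thesis unfolding c_def using that by (intro Min_le) auto
  next
    case False
    have "c \<le> c0" unfolding c_def by (intro Min_le) auto
    then show ?thesis using N[of n] False by simp
  qed
  ultimately show ?thesis using that by (simp add: f_def)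
qed

lemma dist_nearest_int_le: "dist_nearest_int x \<le> \<bar>x - of_int m\<bar>"
  unfolding dist_nearest_int_def using round_diff_minimal[of x m] by simp

lemma symmetric_approximation_badly_approximable:
  assumes "badly_approximable \<theta>"
  obtains c where "c > 0" and
    "\<And>Q. Q \<ge> 1 \<Longrightarrow> \<exists>n m::int. c * Q \<le> \<bar>of_int n\<bar> \<and> \<bar>of_int n\<bar> \<le> Q \<and>
       c * (1 / Q) \<le> \<bar>of_int n * \<theta> - of_int m\<bar> \<and> \<bar>of_int n * \<theta> - of_int m\<bar> \<le> 1 / Q"
proof -
  have irr: "\<theta> \<notin> \<rat>" using assms by (simp add: badly_approximable_def)
  obtain c where "c > 0" and c: "\<And>n::nat. n > 0 \<Longrightarrow> c \<le> real n * dist_nearest_int (real n * \<theta>)"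
    using badly_approximable_lower_bound[OF assms] by blast
  have "\<exists>n m::int. c * Q \<le> \<bar>of_int n\<bar> \<and> \<bar>of_int n\<bar> \<le> Q \<and>
       c * (1 / Q) \<le> \<bar>of_int n * \<theta> - of_int m\<bar> \<and> \<bar>of_int n * \<theta> - of_int m\<bar> \<le> 1 / Q"
    if "Q \<ge> 1" for Q
  proof -
    \<comment> \<open>The denominators start at 1 and eventually exceed \<open>Q\<close>, so there
      is an index \<open>k\<close> at which they cross it.\<close>
    have "Q < of_int (cf_denom \<theta> (nat \<lceil>Q + 1\<rceil>))"
      using cf_denom_ge_index[OF irr, of "nat \<lceil>Q + 1\<rceil>"] \<open>Q \<ge> 1\<close> by linarith
    moreover have "\<not> Q < of_int (cf_denom \<theta> 0)" using that by simp
    ultimately obtain k where k: "of_int (cf_denom \<theta> k) \<le> Q" "Q < of_int (cf_denom \<theta> (Suc k))"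
      using exists_least_lemma[of "\<lambda>k. Q < of_int (cf_denom \<theta> k)"] by (auto simp: not_less)
    define n where "n = cf_denom \<theta> k"
    obtain p :: int where "of_int n * \<theta> - of_int p = (-1) ^ k * cf_error \<theta> k"
      using cf_error_eq_denom_times_minus_int[OF irr] unfolding n_def by blast
    then have p: "\<bar>of_int n * \<theta> - of_int p\<bar> = cf_error \<theta> k"
      using cf_error_pos[OF irr, of k] by (simp add: abs_mult power_abs)
    have n1: "n \<ge> 1" unfolding n_def by (rule cf_denom_ge_1[OF irr])
    have "cf_error \<theta> k \<le> 1 / of_int (cf_denom \<theta> (Suc k))" by (rule cf_error_le[OF irr])
    also have "\<dots> \<le> 1 / Q" using k that by (intro divide_left_mono) auto
    finally have err: "cf_error \<theta> k \<le> 1 / Q" .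
    \<comment> \<open>Bad approximability bounds the product q_k D_k from below. Since the factors
      are at most \<open>Q\<close> and 1/\<open>Q\<close>, each upper bound yields a lower bound for
      the other factor.\<close>
    have "c \<le> of_int n * dist_nearest_int (of_int n * \<theta>)" using c[of "nat n"] n1 by simp
    also have "\<dots> \<le> of_int n * cf_error \<theta> k"
      using dist_nearest_int_le[of "of_int n * \<theta>" p] n1 unfolding p by (intro mult_left_mono) auto
    finally have prod: "c \<le> of_int n * cf_error \<theta> k" .
    also have "\<dots> \<le> of_int n * (1 / Q)" using err n1 by (intro mult_left_mono) auto
    finally have "c * Q \<le> of_int n" using that by (simp add: field_simps)
    moreover have "of_int n * cf_error \<theta> k \<le> Q * cf_error \<theta> k"
      using k cf_error_pos[OF irr, of k] unfolding n_def by (intro mult_right_mono) auto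
    then have "c * (1 / Q) \<le> cf_error \<theta> k" using prod that by (simp add: field_simps)
    ultimately show ?thesis
      using p err k n1 by (intro exI[of _ n] exI[of _ p]) (auto simp: n_def)
  qed
  then show ?thesis using that \<open>c > 0\<close> by blast
qed


section \<open>Growth classes\<close>

text \<open>If a singleton belonged to the ultrafilter, the filter would be principal; hence every
  point can be removed, and by induction every initial segment. This carries limits along the
  natural numbers over to limits along \<open>U\<close>.\<close>

lemma nonprincipal_ultrafilter_le_sequentially:
  assumes "ultrafilter U" and "nonprincipal U"
  shows "U \<le> sequentially"
proof -
  have neq: "eventually (\<lambda>i. i \<noteq> a) U" for a
  proof (rule ccontr)
    assume "\<not> ?thesis"
    then have a: "eventually (\<lambda>i. i = a) U"
      using \<open>ultrafilter U\<close> unfolding ultrafilter_def by (metis (mono_tags))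
    have "U = principal {a}"
    proof (rule filter_eqI)
      fix P
      have "P a" if "eventually P U"
      proof -
        have "eventually (\<lambda>i. P a) U" using that a by eventually_elim simp
        then show ?thesis using \<open>ultrafilter U\<close> by (simp add: ultrafilter_def eventually_const_iff)
      qed
      moreover have "eventually P U" if "P a" using a by eventually_elim (use that in simp)
      ultimately show "eventually P U \<longleftrightarrow> eventually P (principal {a})"
        by (auto simp: eventually_principal)
    qed
    then show False using \<open>nonprincipal U\<close> by (simp add: nonprincipal_def)
  qed
  have ge: "eventually (\<lambda>i. i \<ge> N) U" for N
  proof (induction N)
    case (Suc N)
    from this neq[of N] show ?case by eventually_elim simp
  qed simp
  show ?thesis
    by (rule filter_leI) (auto simp: eventually_sequentially intro: eventually_mono[OF ge])
qed

section \<open>Boundedness, infinitesimality and positivity in terms of representatives\<close>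

lemma ultra_class_in_star_Reals: "ultra_class U x \<in> star_Reals U"
  by (simp add: star_Reals_def ultra_class_def quotientI)

lemma star_Reals_E:
  assumes "X \<in> star_Reals U"
  obtains x where "X = ultra_class U x"
  using assms by (auto simp: star_Reals_def ultra_class_def elim!: quotientE)

lemma ultra_class_in_star_Eps:
  "ultra_class U x \<in> star_Eps U \<longleftrightarrow> (\<forall>r>0. eventually (\<lambda>i. \<bar>x i\<bar> < r) U)"
  by (simp add: star_Eps_def ultra_class_in_star_Reals star_map_ultra_class star_of_def
      star_rel_ultra_class)

lemma ultra_class_in_star_Fin:
  "ultra_class U x \<in> star_Fin U \<longleftrightarrow> (\<exists>r. eventually (\<lambda>i. \<bar>x i\<bar> \<le> r) U)"
  by (simp add: star_Fin_def ultra_class_in_star_Reals star_map_ultra_class star_of_def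
      star_rel_ultra_class)

lemma star_less_0_ultra_class:
  "star_less U (star_of U 0) (ultra_class U x) \<longleftrightarrow> eventually (\<lambda>i. 0 < x i) U"
  by (simp add: star_of_def star_rel_ultra_class)

lemma ultra_class_in_star_nonneg:
  "eventually (\<lambda>i. 0 < x i) U \<Longrightarrow> ultra_class U x \<in> star_nonneg U"
  by (simp add: star_nonneg_def ultra_class_in_star_Reals star_less_0_ultra_class)

lemma ultrafilter_not_eventually_iff:
  assumes "ultrafilter U"
  shows "\<not> eventually P U \<longleftrightarrow> eventually (\<lambda>i. \<not> P i) U"
proof
  assume *: "eventually (\<lambda>i. \<not> P i) U"
  show "\<not> eventually P U"
  proof
    assume "eventually P U"
    with * have "eventually (\<lambda>i. False) U" by eventually_elim simp
    then show False using assms by (simp add: ultrafilter_def eventually_False)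
  qed
qed (use assms in \<open>auto simp: ultrafilter_def\<close>)

lemma ultra_class_not_in_star_Eps:
  assumes "ultrafilter U"
  shows "ultra_class U x \<notin> star_Eps U \<longleftrightarrow> (\<exists>r>0. eventually (\<lambda>i. r \<le> \<bar>x i\<bar>) U)"
proof -
  from ultrafilter_not_eventually_iff[OF assms, of "\<lambda>i. \<bar>x i\<bar> < r" for r] show ?thesis
    unfolding ultra_class_in_star_Eps by (auto simp: not_less)
qed

section \<open>Growth classes as two-sided comparability of sequences\<close>

lemma pos_if_mult_le:
  fixes a x y :: real
  assumes "0 < a" "0 < x" "a * x \<le> y"
  shows "0 < y"
  using mult_pos_pos[OF assms(1,2)] assms(3) by linarith

lemma factor_pos_if_le_mult:
  fixes b x y :: real
  assumes "0 < y" "0 < x" "y \<le> b * x"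
  shows "0 < b"
  using zero_less_mult_pos2[of b x] assms by linarith

text \<open>A positive factor that is neither infinite nor infinitesimal is represented by a
  sequence between two real constants, the lower one positive. This turns all later work on growths
  into pointwise inequalities.\<close>

lemma growth_rel_ultra_class:
  assumes "ultrafilter U" and x: "eventually (\<lambda>i. 0 < x i) U"
  shows "(ultra_class U x, Y) \<in> growth_rel U \<longleftrightarrow>
    (\<exists>y a b. Y = ultra_class U y \<and> 0 < a \<and> eventually (\<lambda>i. a * x i \<le> y i \<and> y i \<le> b * x i) U)"
proof
  assume "(ultra_class U x, Y) \<in> growth_rel U"
  then obtain C where C: "C \<in> star_Fin U" "C \<notin> star_Eps U" "star_less U (star_of U 0) C"
    and Y: "Y = star_times U C (ultra_class U x)"
    by (auto simp: growth_rel_def star_Fin_units_pos_def)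
  then obtain c where c: "C = ultra_class U c"
    by (auto simp: star_Fin_def elim: star_Reals_E)
  obtain a b where a: "0 < a" "eventually (\<lambda>i. a \<le> \<bar>c i\<bar>) U" and b: "eventually (\<lambda>i. \<bar>c i\<bar> \<le> b) U"
    using C unfolding c ultra_class_in_star_Fin ultra_class_not_in_star_Eps[OF \<open>ultrafilter U\<close>] by blast
  have pos: "eventually (\<lambda>i. 0 < c i) U" using C unfolding c star_less_0_ultra_class by blast
  from a(2) b pos x have "eventually (\<lambda>i. a * x i \<le> c i * x i \<and> c i * x i \<le> b * x i) U"
    by eventually_elim simp
  then show "\<exists>y a b. Y = ultra_class U y \<and> 0 < a \<and>
      eventually (\<lambda>i. a * x i \<le> y i \<and> y i \<le> b * x i) U"
    using a(1) unfolding Y c star_map2_ultra_class by blast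
next
  assume "\<exists>y a b. Y = ultra_class U y \<and> 0 < a \<and>
      eventually (\<lambda>i. a * x i \<le> y i \<and> y i \<le> b * x i) U"
  then obtain y a b where Y: "Y = ultra_class U y" and "0 < a"
    and ab: "eventually (\<lambda>i. a * x i \<le> y i \<and> y i \<le> b * x i) U" by blast
  \<comment> \<open>Conversely, the quotient represents the required unit; the bounds trap it
    between \<open>a\<close> and \<open>b\<close>.\<close>
  define c where "c i = y i / x i" for i
  have c: "eventually (\<lambda>i. a \<le> c i \<and> c i \<le> b) U"
    using ab x by eventually_elim (simp add: c_def field_simps)
  have "eventually (\<lambda>i. 0 < c i) U" "eventually (\<lambda>i. a \<le> \<bar>c i\<bar>) U" "eventually (\<lambda>i. \<bar>c i\<bar> \<le> b) U"
    using c \<open>0 < a\<close> by (auto elim!: eventually_mono)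
  then have "ultra_class U c \<in> star_Fin_units_pos U"
    using \<open>0 < a\<close> unfolding star_Fin_units_pos_def
    by (auto simp: star_less_0_ultra_class ultra_class_in_star_Fin
        ultra_class_not_in_star_Eps[OF \<open>ultrafilter U\<close>])
  moreover have "Y = star_times U (ultra_class U c) (ultra_class U x)"
    unfolding Y star_map2_ultra_class ultra_class_eq_iff
    using x by eventually_elim (simp add: c_def)
  moreover have "eventually (\<lambda>i. 0 < y i) U"
    using ab x by eventually_elim (rule pos_if_mult_le[OF \<open>0 < a\<close>], auto)
  ultimately show "(ultra_class U x, Y) \<in> growth_rel U"
    using ultra_class_in_star_nonneg[OF x] ultra_class_in_star_nonneg[of y U]
    unfolding growth_rel_def Y by blast
qed

lemma growth_rel_Image_subset:
  assumes "ultrafilter U" and x: "eventually (\<lambda>i. 0 < x i) U" and y: "eventually (\<lambda>i. 0 < y i) U"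
    and "0 < a" and ab: "eventually (\<lambda>i. a * x i \<le> y i \<and> y i \<le> b * x i) U"
  shows "growth_rel U `` {ultra_class U y} \<subseteq> growth_rel U `` {ultra_class U x}"
proof
  fix Z assume "Z \<in> growth_rel U `` {ultra_class U y}"
  then obtain z a' b' where Z: "Z = ultra_class U z" and "0 < a'"
    and ab': "eventually (\<lambda>i. a' * y i \<le> z i \<and> z i \<le> b' * y i) U"
    using growth_rel_ultra_class[OF assms(1) y] by auto
  \<comment> \<open>The sign of \<open>b'\<close> is not known at this point, so its absolute value
    is used to keep multiplication monotone.\<close>
  have "eventually (\<lambda>i. a' * a * x i \<le> z i \<and> z i \<le> \<bar>b'\<bar> * b * x i) U"
    using ab ab' y
  proof eventually_elim
    case (elim i)
    have "a' * (a * x i) \<le> a' * y i" using elim \<open>0 < a'\<close> by (intro mult_left_mono) auto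
    moreover have "b' * y i \<le> \<bar>b'\<bar> * y i" using elim by (intro mult_right_mono) auto
    moreover have "\<bar>b'\<bar> * y i \<le> \<bar>b'\<bar> * (b * x i)" using elim by (intro mult_left_mono) auto
    ultimately show ?case using elim unfolding mult.assoc by linarith
  qed
  then have "(ultra_class U x, Z) \<in> growth_rel U"
    using growth_rel_ultra_class[OF assms(1) x] Z \<open>0 < a\<close> \<open>0 < a'\<close> by (metis mult_pos_pos)
  then show "Z \<in> growth_rel U `` {ultra_class U x}" by simp
qed

lemma growth_of_eqI:
  assumes "ultrafilter U" and x: "eventually (\<lambda>i. 0 < x i) U"
    and "0 < a" and ab: "eventually (\<lambda>i. a * x i \<le> \<bar>y i\<bar> \<and> \<bar>y i\<bar> \<le> b * x i) U"
  shows "growth_of U (ultra_class U y) = growth_of U (ultra_class U x)"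
proof -
  have y: "eventually (\<lambda>i. 0 < \<bar>y i\<bar>) U"
    using ab x by eventually_elim (rule pos_if_mult_le[OF \<open>0 < a\<close>], auto)
  have abs_x: "ultra_class U (\<lambda>i. \<bar>x i\<bar>) = ultra_class U x"
    unfolding ultra_class_eq_iff using x by eventually_elim simp
  \<comment> \<open>A constant statement that holds eventually is true because the filter is proper.
    Positivity of \<open>b\<close> is needed to invert the comparison.\<close>
  have "eventually (\<lambda>i. 0 < b) U"
    using ab x y by eventually_elim (blast intro: factor_pos_if_le_mult)
  then have "0 < b"
    using assms(1) by (simp add: ultrafilter_def eventually_const_iff)
  have "eventually (\<lambda>i. 1 / b * \<bar>y i\<bar> \<le> x i \<and> x i \<le> 1 / a * \<bar>y i\<bar>) U"
    using ab by eventually_elim (use \<open>0 < a\<close> \<open>0 < b\<close> in \<open>auto simp: field_simps\<close>)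
  then show ?thesis
    unfolding growth_of_def star_map_ultra_class abs_x
    using growth_rel_Image_subset[OF assms(1) x y \<open>0 < a\<close> ab]
      growth_rel_Image_subset[OF assms(1) y x, of "1 / b" "1 / a"] \<open>0 < b\<close> by auto
qed

text \<open>Comparability survives inversion, so all members of the class of \<open>x\<close>
  contribute the same growth to the union defining \<open>growth_inverse\<close>. Reflexivity
  ensures that the union is taken over a nonempty class.\<close>

lemma mu_growth_ultra_class:
  assumes "ultrafilter U" and x: "eventually (\<lambda>i. 0 < x i) U"
  shows "mu_growth U (ultra_class U x) = growth_of U (ultra_class U (\<lambda>i. 1 / x i))"
proof -
  have abs_x: "ultra_class U (\<lambda>i. \<bar>x i\<bar>) = ultra_class U x"
    unfolding ultra_class_eq_iff using x by eventually_elim simp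
  have g: "growth_of U (ultra_class U x) = growth_rel U `` {ultra_class U x}"
    by (simp add: growth_of_def star_map_ultra_class abs_x)
  have "growth_of U (star_map U inverse Y) = growth_of U (ultra_class U (\<lambda>i. 1 / x i))"
    if Y: "(ultra_class U x, Y) \<in> growth_rel U" for Y
  proof -
    obtain y a b where Y: "Y = ultra_class U y" and "0 < a"
      and ab: "eventually (\<lambda>i. a * x i \<le> y i \<and> y i \<le> b * x i) U"
      using Y unfolding growth_rel_ultra_class[OF assms] by blast
    have y: "eventually (\<lambda>i. 0 < y i) U"
      using ab x by eventually_elim (rule pos_if_mult_le[OF \<open>0 < a\<close>], auto)
    have "eventually (\<lambda>i. 0 < b) U"
      using ab x y by eventually_elim (blast intro: factor_pos_if_le_mult)
    then have "0 < b"
      using assms(1) by (simp add: ultrafilter_def eventually_const_iff)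
    have "eventually (\<lambda>i. 1 / b * (1 / x i) \<le> \<bar>inverse (y i)\<bar> \<and> \<bar>inverse (y i)\<bar> \<le> 1 / a * (1 / x i)) U"
      using ab x y
    proof eventually_elim
      case (elim i)
      then have "inverse (b * x i) \<le> inverse (y i)" "inverse (y i) \<le> inverse (a * x i)"
        using \<open>0 < a\<close> by (auto intro!: le_imp_inverse_le simp del: inverse_mult_distrib)
      then show ?case using elim by (simp add: divide_inverse)
    qed
    moreover have "eventually (\<lambda>i. 0 < 1 / x i) U" using x by eventually_elim simp
    ultimately show ?thesis
      unfolding Y star_map_ultra_class
      using \<open>0 < b\<close> by (intro growth_of_eqI[OF assms(1), where a = "1 / b" and b = "1 / a"]) auto
  qed
  moreover have "(ultra_class U x, ultra_class U x) \<in> growth_rel U"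
    unfolding growth_rel_ultra_class[OF assms]
    by (rule exI[of _ x], rule exI[of _ 1], rule exI[of _ 1]) simp
  ultimately show ?thesis
    unfolding mu_growth_def growth_inverse_def g by blast
qed

section \<open>From sequences of integers to symmetric approximations\<close>

lemma perp_ultra_class:
  fixes n m :: "nat \<Rightarrow> int"
  assumes eps: "\<And>r. r > 0 \<Longrightarrow> eventually (\<lambda>i. \<bar>of_int (n i) * \<theta> - of_int (m i)\<bar> < r) U"
  shows "perp U \<theta> (ultra_class U (\<lambda>i. of_int (n i))) = ultra_class U (\<lambda>i. of_int (m i))"
  unfolding perp_def
proof (rule the_equality, goal_cases)
  case 1
  show ?case
    using eps by (auto simp: star_Ints_def star_of_def star_map2_ultra_class ultra_class_in_star_Eps)
next
  case (2 M)
  then obtain m' where M: "M = ultra_class U m'" and int: "\<And>i. m' i \<in> \<int>" 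
    by (auto simp: star_Ints_def)
  then have "eventually (\<lambda>i. \<bar>of_int (n i) * \<theta> - m' i\<bar> < 1/2) U"
    using 2 by (simp add: star_of_def star_map2_ultra_class ultra_class_in_star_Eps del: less_divide_eq_numeral1)
  moreover have "eventually (\<lambda>i. \<bar>of_int (n i) * \<theta> - of_int (m i)\<bar> < 1/2) U"
    by (rule eps) simp
  \<comment> \<open>Two integers within 1/2 of the same real differ by less than 1 and therefore
    coincide.\<close>
  ultimately have "eventually (\<lambda>i. m' i = of_int (m i)) U"
  proof (eventually_elim)
    case (elim i)
    then have "\<bar>m' i - of_int (m i)\<bar> < 1" by linarith
    then show ?case using Ints_nonzero_abs_less1[of "m' i - of_int (m i)"] int[of i] by simp
  qed
  then show ?case by (simp add: M ultra_class_eq_iff)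
qed

text \<open>The bridge between the two halves: multiplying the bounds for size and error cancels
  \<open>Q\<close> and leaves the constants a^2 and b^2, which is symmetry, while the error bounds
  alone fix the growth.\<close>

lemma ultra_class_in_star_Ints_sym_nu:
  fixes n m :: "nat \<Rightarrow> int" and Q :: "nat \<Rightarrow> real"
  assumes U: "ultrafilter U" and Q: "filterlim Q at_top U" and "0 < a"
    and n: "eventually (\<lambda>i. a * Q i \<le> \<bar>of_int (n i)\<bar> \<and> \<bar>of_int (n i)\<bar> \<le> b * Q i) U"
    and m: "eventually (\<lambda>i. a * (1 / Q i) \<le> \<bar>of_int (n i) * \<theta> - of_int (m i)\<bar> \<and>
                            \<bar>of_int (n i) * \<theta> - of_int (m i)\<bar> \<le> b * (1 / Q i)) U"
  defines "N \<equiv> ultra_class U (\<lambda>i. of_int (n i))"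
  shows "N \<in> star_Ints_sym_nu U \<theta> (growth_of U (ultra_class U (\<lambda>i. 1 / Q i)))"
    and "N \<noteq> star_of U 0"
proof -
  have pos: "eventually (\<lambda>i. 0 < Q i) U"
    using Q by (simp add: filterlim_at_top_dense)
  have eps: "eventually (\<lambda>i. \<bar>of_int (n i) * \<theta> - of_int (m i)\<bar> < r) U" if "r > 0" for r
  proof -
    have "eventually (\<lambda>i. b / r < Q i) U" using Q by (simp add: filterlim_at_top_dense)
    with m pos show ?thesis
    proof eventually_elim
      case (elim i)
      then have "b * (1 / Q i) < r" using that by (simp add: field_simps)
      with elim show ?case by linarith
    qed
  qed
  define e where "e = (\<lambda>i. of_int (n i) * \<theta> - of_int (m i))"
  have err: "approx_error U \<theta> N = ultra_class U e"
    using perp_ultra_class[OF eps]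
    by (simp add: approx_error_def N_def e_def star_of_def star_map2_ultra_class)
  have "N \<in> star_Ints U" "ultra_class U (\<lambda>i. of_int (m i)) \<in> star_Ints U"
    by (auto simp: N_def star_Ints_def)
  moreover have "star_minus U (star_times U N (star_of U \<theta>)) (ultra_class U (\<lambda>i. of_int (m i))) \<in> star_Eps U"
    using eps by (simp add: N_def star_of_def star_map2_ultra_class ultra_class_in_star_Eps)
  ultimately have approx: "N \<in> star_Ints_approx U \<theta>" unfolding star_Ints_approx_def by blast
  have "eventually (\<lambda>i. 0 < \<bar>real_of_int (n i)\<bar>) U"
    using n pos by eventually_elim (rule pos_if_mult_le[OF \<open>0 < a\<close>], auto)
  then have "eventually (\<lambda>i. of_int (n i) \<noteq> (0::real)) U" by eventually_elim simp
  then have "\<not> eventually (\<lambda>i. of_int (n i) = (0::real)) U"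
    by (simp add: ultrafilter_not_eventually_iff[OF U])
  then show nz: "N \<noteq> star_of U 0"
    by (simp add: N_def star_of_def ultra_class_eq_iff)
  have ab: "eventually (\<lambda>i. a * a \<le> \<bar>of_int (n i)\<bar> * \<bar>e i\<bar> \<and> \<bar>of_int (n i)\<bar> * \<bar>e i\<bar> \<le> b * b) U"
    using n m pos
  proof eventually_elim
    case (elim i)
    have "(a * Q i) * (a * (1 / Q i)) \<le> \<bar>of_int (n i)\<bar> * \<bar>e i\<bar>"
      using elim \<open>0 < a\<close> by (intro mult_mono) (auto simp: e_def)
    \<comment> \<open>Nonnegativity of \<open>b * Q i\<close> comes from its being an upper bound of
      an absolute value.\<close>
    moreover have "\<bar>of_int (n i)\<bar> * \<bar>e i\<bar> \<le> (b * Q i) * (b * (1 / Q i))"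
      using elim by (intro mult_mono) (auto simp: e_def intro: order_trans[OF abs_ge_zero])
    ultimately show ?case using elim by simp
  qed
  have "star_times U (star_abs U N) (star_abs U (approx_error U \<theta> N)) \<in> star_Fin U - star_Eps U"
    unfolding err unfolding N_def star_map_ultra_class star_map2_ultra_class
  proof (intro DiffI)
    show "ultra_class U (\<lambda>i. \<bar>of_int (n i)\<bar> * \<bar>e i\<bar>) \<in> star_Fin U"
      unfolding ultra_class_in_star_Fin
      by (rule exI[of _ "b * b"]) (use ab in \<open>auto simp: abs_mult elim!: eventually_mono\<close>)
    show "ultra_class U (\<lambda>i. \<bar>of_int (n i)\<bar> * \<bar>e i\<bar>) \<notin> star_Eps U"
      unfolding ultra_class_not_in_star_Eps[OF U]
      by (rule exI[of _ "a * a"])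
        (use ab \<open>0 < a\<close> in \<open>auto simp: abs_mult elim!: eventually_mono\<close>)
  qed
  with approx nz have "N \<in> star_Ints_sym U \<theta>" unfolding star_Ints_sym_def by blast
  moreover have "nu_growth U \<theta> N = growth_of U (ultra_class U (\<lambda>i. 1 / Q i))"
    unfolding nu_growth_def err
  proof (rule growth_of_eqI[OF U _ \<open>0 < a\<close>])
    show "eventually (\<lambda>i. 0 < 1 / Q i) U" using pos by eventually_elim simp
    show "eventually (\<lambda>i. a * (1 / Q i) \<le> \<bar>e i\<bar> \<and> \<bar>e i\<bar> \<le> b * (1 / Q i)) U"
      using m by (simp add: e_def)
  qed
  ultimately show "N \<in> star_Ints_sym_nu U \<theta> (growth_of U (ultra_class U (\<lambda>i. 1 / Q i)))"
    unfolding star_Ints_sym_nu_def by blast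
qed

lemma star_Ints_sym_nu_nonzero:
  fixes Q :: "nat \<Rightarrow> real"
  assumes U: "ultrafilter U" and Q: "filterlim Q at_top U" and "0 < a"
    and ex: "eventually (\<lambda>i. \<exists>n m::int. a * Q i \<le> \<bar>of_int n\<bar> \<and> \<bar>of_int n\<bar> \<le> b * Q i \<and>
       a * (1 / Q i) \<le> \<bar>of_int n * \<theta> - of_int m\<bar> \<and> \<bar>of_int n * \<theta> - of_int m\<bar> \<le> b * (1 / Q i)) U"
  shows "\<exists>N \<in> star_Ints_sym_nu U \<theta> (growth_of U (ultra_class U (\<lambda>i. 1 / Q i))). N \<noteq> star_of U 0"
proof -
  let ?P = "\<lambda>i (n::int) (m::int). a * Q i \<le> \<bar>of_int n\<bar> \<and> \<bar>of_int n\<bar> \<le> b * Q i \<and>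
       a * (1 / Q i) \<le> \<bar>of_int n * \<theta> - of_int m\<bar> \<and> \<bar>of_int n * \<theta> - of_int m\<bar> \<le> b * (1 / Q i)"
  \<comment> \<open>The guarded form allows a choice at every index; where no suitable pair exists,
    the chosen integers are arbitrary, which does not affect the class.\<close>
  have "\<forall>i. \<exists>n m. (\<exists>n m. ?P i n m) \<longrightarrow> ?P i n m" by blast
  from choice[OF this] obtain n where "\<forall>i. \<exists>m. (\<exists>n m. ?P i n m) \<longrightarrow> ?P i (n i) m" ..
  from choice[OF this] obtain m where "\<forall>i. (\<exists>n m. ?P i n m) \<longrightarrow> ?P i (n i) (m i)" ..
  with ex have P: "eventually (\<lambda>i. ?P i (n i) (m i)) U" by (auto elim!: eventually_mono)
  show ?thesis
    using ultra_class_in_star_Ints_sym_nu[OF U Q \<open>0 < a\<close>, of n b \<theta> m] P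
    by (auto simp: eventually_conj_iff)
qed

section \<open>Assembly: best denominator growths, then all infinitesimal growths\<close>

theorem theorem17:
  fixes U :: "nat filter" and \<theta> :: real
  assumes "ultrafilter U" and "nonprincipal U" and "\<theta> \<notin> \<rat>"
  shows "(\<forall>\<nu> \<in> Growths_bg U \<theta>. \<exists>n \<in> star_Ints_sym_nu U \<theta> \<nu>. n \<noteq> star_of U 0) \<and>
    (badly_approximable \<theta> \<longrightarrow>
      (\<forall>\<nu> \<in> Growths_eps U. \<exists>n \<in> star_Ints_sym_nu U \<theta> \<nu>. n \<noteq> star_of U 0))"
proof (intro conjI ballI impI)
  fix \<nu> assume "\<nu> \<in> Growths_bg U \<theta>"
  then obtain k where \<nu>: "\<nu> = mu_growth U (ultra_class U (\<lambda>i. of_int (cf_denom \<theta> (k i))))"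
    and "filterlim k at_top sequentially"
    by (auto simp: Growths_bg_def best_denom_classes_def)
  then have k: "filterlim k at_top U"
    using nonprincipal_ultrafilter_le_sequentially[OF assms(1,2)] filterlim_mono by blast
  define Q where "Q = (\<lambda>i. real_of_int (cf_denom \<theta> (k i)))"
  have Q_pos: "Q i > 0" for i
    using cf_denom_ge_1[OF assms(3), of "k i"] by (simp add: Q_def)
  have Q: "filterlim Q at_top U"
  proof (rule filterlim_at_top_mono)
    show "filterlim (\<lambda>i. real (k i)) at_top U"
      using filterlim_compose[OF filterlim_real_sequentially k] .
    have "real (k i) \<le> Q i" for i
      using cf_denom_ge_index[OF assms(3), of "k i"] unfolding Q_def by linarith
    then show "eventually (\<lambda>i. real (k i) \<le> Q i) U" by simp
  qed
  have \<nu>_eq: "\<nu> = growth_of U (ultra_class U (\<lambda>i. 1 / Q i))"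
    using mu_growth_ultra_class[OF assms(1), of Q] Q_pos unfolding \<nu> Q_def by simp
  \<comment> \<open>The finite-level construction uses the preceding convergent, so index 0 has to
    be excluded.\<close>
  have "eventually (\<lambda>i. 0 < k i) U" using k unfolding filterlim_at_top by (simp add: Suc_le_eq[symmetric])
  then have "eventually (\<lambda>i. \<exists>n m::int. 1/2 * Q i \<le> \<bar>of_int n\<bar> \<and> \<bar>of_int n\<bar> \<le> 3 * Q i \<and>
     1/2 * (1 / Q i) \<le> \<bar>of_int n * \<theta> - of_int m\<bar> \<and> \<bar>of_int n * \<theta> - of_int m\<bar> \<le> 3 * (1 / Q i)) U"
  proof eventually_elim
    case (elim i)
    obtain n m :: int where "Q i \<le> \<bar>of_int n\<bar>" "\<bar>of_int n\<bar> \<le> 3 * Q i"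
      "1/2 * (1 / Q i) \<le> \<bar>of_int n * \<theta> - of_int m\<bar>" "\<bar>of_int n * \<theta> - of_int m\<bar> \<le> 3 * (1 / Q i)"
      using symmetric_approximation_cf_denom[OF assms(3) elim] unfolding Q_def by blast
    moreover have "1/2 * Q i \<le> Q i" using Q_pos[of i] by simp
    ultimately show ?case by (meson order_trans)
  qed
  then show "\<exists>n \<in> star_Ints_sym_nu U \<theta> \<nu>. n \<noteq> star_of U 0"
    unfolding \<nu>_eq by (intro star_Ints_sym_nu_nonzero[OF assms(1) Q, of "1/2" 3]) simp_all
next
  fix \<nu> assume "badly_approximable \<theta>" and "\<nu> \<in> Growths_eps U"
  then obtain X where \<nu>: "\<nu> = growth_of U X" and X: "X \<in> star_Eps U" "star_less U (star_of U 0) X"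
    by (auto simp: Growths_eps_def)
  then obtain x where x: "X = ultra_class U x" by (auto simp: star_Eps_def elim: star_Reals_E)
  have pos: "eventually (\<lambda>i. 0 < x i) U" using X by (simp add: x star_less_0_ultra_class)
  have eps: "\<And>r. r > 0 \<Longrightarrow> eventually (\<lambda>i. \<bar>x i\<bar> < r) U"
    using X by (simp add: x ultra_class_in_star_Eps)
  \<comment> \<open>An arbitrary infinitesimal growth is written as that of 1/\<open>Q\<close>. The
    double inverse returns \<open>x\<close> at every index, zeros included, so the class obtained at
    the end is the given one.\<close>
  define Q where "Q = (\<lambda>i. 1 / x i)"
  have Q: "filterlim Q at_top U"
  proof (subst filterlim_at_top_gt[where c = 0], intro allI impI)
    fix Z :: real assume "Z > 0"
    show "eventually (\<lambda>i. Z \<le> Q i) U"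
      using pos eps[of "1 / Z"] \<open>Z > 0\<close> by (auto simp: Q_def field_simps elim: eventually_elim2)
  qed
  obtain c where "c > 0" and c: "\<And>Q. Q \<ge> 1 \<Longrightarrow> \<exists>n m::int. c * Q \<le> \<bar>of_int n\<bar> \<and> \<bar>of_int n\<bar> \<le> Q \<and>
       c * (1 / Q) \<le> \<bar>of_int n * \<theta> - of_int m\<bar> \<and> \<bar>of_int n * \<theta> - of_int m\<bar> \<le> 1 / Q"
    using symmetric_approximation_badly_approximable[OF \<open>badly_approximable \<theta>\<close>] by metis
  have "eventually (\<lambda>i. 1 \<le> Q i) U" using Q by (simp add: filterlim_at_top)
  then have "eventually (\<lambda>i. \<exists>n m::int. c * Q i \<le> \<bar>of_int n\<bar> \<and> \<bar>of_int n\<bar> \<le> 1 * Q i \<and>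
     c * (1 / Q i) \<le> \<bar>of_int n * \<theta> - of_int m\<bar> \<and> \<bar>of_int n * \<theta> - of_int m\<bar> \<le> 1 * (1 / Q i)) U"
    unfolding mult_1 by (rule eventually_mono) (rule c)
  from star_Ints_sym_nu_nonzero[OF assms(1) Q \<open>c > 0\<close> this]
  show "\<exists>n \<in> star_Ints_sym_nu U \<theta> \<nu>. n \<noteq> star_of U 0"
    by (simp add: \<nu> x Q_def)
qed

end
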